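(* Let $A\in\mathbb{R}^{n\times m}$ have singular values $\sigma_1\ge\sigma_2\ge\cdots$, and let $S=A(I,J)$ be a nonsingular $k\times k$ submatrix of $A$, where $I=(i_1,\ldots,i_k)$ and $J=(j_1,\ldots,j_k)$ are ordered tuples of row and column indices. If $\sigma_1=1$, then $$\big\|A-A(:,J)S^{-1}A(I,:)\big\|_{\max}\le\frac{\sigma_{k+1}}{|\det S|}.$$
   Context: $\|\cdot\|_{\max}$ is the largest absolute value of an entry. $A(:,J)$ and $A(I,:)$ are the selected columns and rows of $A$, and $A(I,J)$ is the matrix with entries $A_{i_aj_b}$. Convention: $\sigma_q=0$ for $q>\operatorname{rank}(A)$ (including $q>\min\{m,n\}$). *)

theory Defs
  imports
    "Jordan_Normal_Form.Char_Poly"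
    "Jordan_Normal_Form.Gauss_Jordan_Elimination"
    "HOL-Library.Multiset"
begin

text \<open>
  Row and column indices are 0-based, as everywhere in the matrix library. An ordered
  index tuple is a list of indices; neither monotonicity nor distinctness is built in.
\<close>

definition select_cols :: "'a mat \<Rightarrow> nat list \<Rightarrow> 'a mat" where
  "select_cols A J = mat_of_cols (dim_row A) (map (col A) J)"

definition select_rows :: "'a mat \<Rightarrow> nat list \<Rightarrow> 'a mat" where
  "select_rows A I = mat_of_rows (dim_col A) (map (row A) I)"

text \<open>
  The library constant \<open>submatrix\<close> takes index sets and so forgets the order of the indices.
\<close>

definition select_submat :: "'a mat \<Rightarrow> nat list \<Rightarrow> nat list \<Rightarrow> 'a mat" where
  "select_submat A I J = mat (length I) (length J) (\<lambda>(a, b). A $$ (I ! a, J ! b))"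

text \<open>The library inverse is option-valued; the value is unspecified for singular matrices.\<close>

definition inverse_mat :: "'a :: field mat \<Rightarrow> 'a mat" where
  "inverse_mat A = the (mat_inverse A)"

lemma inverse_mat:
  assumes A: "A \<in> carrier_mat n n" and inv: "invertible_mat A"
  shows "inverse_mat A \<in> carrier_mat n n"
    and "A * inverse_mat A = 1\<^sub>m n"
    and "inverse_mat A * A = 1\<^sub>m n"
proof -
  from inv A obtain B where B: "A * B = 1\<^sub>m n" "B * A = 1\<^sub>m (dim_row B)"
    unfolding invertible_mat_def inverts_mat_def by auto
  have "dim_col B = n" using arg_cong[OF B(1), of dim_col] by simp
  moreover have "dim_row B = n" using arg_cong[OF B(2), of dim_col] A by simp
  ultimately have BC: "B \<in> carrier_mat n n" by auto
  have "A \<in> Units (ring_mat TYPE('a) n ())"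
    unfolding Units_def using A B BC by (auto simp: ring_mat_simps)
  then obtain C where C: "mat_inverse A = Some C"
    using mat_inverse(1)[OF A, where b = "()"] by (cases "mat_inverse A") auto
  from mat_inverse(2)[OF A C] C
  show "inverse_mat A \<in> carrier_mat n n" "A * inverse_mat A = 1\<^sub>m n"
    "inverse_mat A * A = 1\<^sub>m n"
    by (auto simp: inverse_mat_def)
qed

text \<open>Only meaningful for matrices with at least one entry.\<close>

definition max_norm :: "real mat \<Rightarrow> real" where
  "max_norm A = Max (abs ` elements_mat A)"

text \<open>
  The square roots of the eigenvalues of \<open>A\<^sup>T A\<close>, with multiplicity and in decreasing order.
  Since \<open>A\<^sup>T A\<close> is symmetric, its characteristic polynomial splits over the reals, so this list
  has length \<open>dim_col A\<close>; its entries beyond the rank of \<open>A\<close> are zero.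
\<close>

definition singular_values :: "real mat \<Rightarrow> real list" where
  "singular_values A =
     rev (sorted_list_of_multiset (image_mset sqrt (proots (char_poly (transpose_mat A * A)))))"

text \<open>The \<open>q\<close>-th singular value, counted from 1 and extended by zero past the end of the list.\<close>

definition singular_value :: "real mat \<Rightarrow> nat \<Rightarrow> real" where
  "singular_value A q =
     (if 1 \<le> q \<and> q \<le> length (singular_values A) then singular_values A ! (q - 1) else 0)"

end

theory Submission
  imports Defs
begin

text \<open>
  Entry \<open>(i, j)\<close> of the residual \<open>A - A(:,J) S\<^sup>-\<^sup>1 A(I,:)\<close> is a Schur complement, namely
  \<open>det M / det S\<close>, where \<open>M\<close> is \<open>S\<close> bordered by row \<open>i\<close> and column \<open>j\<close> of \<open>A\<close>
  (\<open>det_bordered_submat\<close>). It remains to see that a minor of order \<open>k + 1\<close> is bounded by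
  \<open>\<sigma>\<^bsub>k+1\<^esub>\<close> whenever \<open>\<sigma>\<^sub>1 \<le> 1\<close> (\<open>abs_minor_le_singular_value\<close>). When an index
  repeats, the minor is zero. Otherwise \<open>M\<close> is a compression of \<open>A\<close>, hence a contraction, and
  by a dimension count it stretches some nonzero vector by at most \<open>\<sigma>\<^bsub>k+1\<^esub>\<close>. As all
  eigenvalues of \<open>M\<^sup>T M\<close> lie in \<open>[0, 1]\<close>, their product \<open>(det M)\<^sup>2\<close> is at most the
  smallest of them, and so at most \<open>\<sigma>\<^bsub>k+1\<^esub>\<^sup>2\<close> (\<open>det_square_le_contraction\<close>).

  Both \<open>A\<^sup>T A\<close> and \<open>M\<^sup>T M\<close> are diagonalized by the real spectral theorem, proved here by
  deflation with Householder reflections; the characteristic polynomial splits over the reals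
  because the complex eigenvalues of a real symmetric matrix are real.
\<close>

section \<open>The spectral theorem for real symmetric matrices\<close>

lemma symmetric_eigenvalue_real:
  fixes H :: "real mat"
  assumes H: "H \<in> carrier_mat n n" and sym: "H\<^sup>T = H"
    and ev: "eigenvalue (map_mat complex_of_real H) a"
  shows "a \<in> \<real>"
proof -
  let ?C = "map_mat complex_of_real H"
  have C: "?C \<in> carrier_mat n n" using H by simp
  have herm: "?C\<^sup>T = ?C" using sym by (metis map_mat_transpose)
  from ev obtain v where v: "v \<in> carrier_vec n" "v \<noteq> 0\<^sub>v n" "?C *\<^sub>v v = a \<cdot>\<^sub>v v"
    using C unfolding eigenvalue_def eigenvector_def by auto
  let ?w = "conjugate v"
  have w: "?w \<in> carrier_vec n" using v by simp
  have conj: "?C *\<^sub>v ?w = cnj a \<cdot>\<^sub>v ?w"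
  proof (rule eq_vecI)
    fix i assume i: "i < dim_vec (cnj a \<cdot>\<^sub>v ?w)"
    then have i': "i < n" using v by simp
    have "(?C *\<^sub>v ?w) $ i = cnj ((?C *\<^sub>v v) $ i)"
      using i' H v(1) by (simp add: scalar_prod_def)
    also have "\<dots> = cnj a * ?w $ i" unfolding v(3) using i' v(1) by simp
    finally show "(?C *\<^sub>v ?w) $ i = (cnj a \<cdot>\<^sub>v ?w) $ i" using i' v by simp
  qed (use H v(1) in simp)
  have "a * (v \<bullet> ?w) = (?C *\<^sub>v v) \<bullet> ?w" using v w by simp
  also have "\<dots> = v \<bullet> (?C *\<^sub>v ?w)"
    using transpose_vec_mult_scalar[OF C w v(1)] herm by simp
  also have "\<dots> = cnj a * (v \<bullet> ?w)" using conj v w by simp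
  finally have "a = cnj a" using v conjugate_square_eq_0_vec[OF v(1)] by simp
  then show ?thesis by (simp add: Reals_cnj_iff)
qed

lemma symmetric_char_poly_splits:
  fixes H :: "real mat"
  assumes H: "H \<in> carrier_mat n n" and sym: "H\<^sup>T = H"
  obtains es where "char_poly H = (\<Prod>e\<leftarrow>es. [:- e, 1:])" and "length es = n"
proof -
  let ?C = "map_mat complex_of_real H"
  have C: "?C \<in> carrier_mat n n" using H by simp
  obtain as where as: "char_poly ?C = (\<Prod>a\<leftarrow>as. [:- a, 1:])" "length as = n"
    using char_poly_factorized[OF C] by auto
  define es where "es = map Re as"
  have real: "complex_of_real (Re a) = a" if "a \<in> set as" for a
  proof -
    have "poly (char_poly ?C) a = 0"
      using that unfolding as(1) poly_prod_list prod_list_zero_iff by auto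
    then show ?thesis
      using symmetric_eigenvalue_real[OF H sym] eigenvalue_root_char_poly[OF C] by simp
  qed
  interpret inj_comm_ring_hom complex_of_real by unfold_locales auto
  interpret P: map_poly_inj_comm_ring_hom complex_of_real ..
  have "char_poly ?C = map_poly complex_of_real (char_poly H)"
    by (rule of_real_hom.char_poly_hom[OF H])
  then have "map_poly complex_of_real (char_poly H) = (\<Prod>a\<leftarrow>as. [:- a, 1:])"
    using as(1) by simp
  also have "\<dots> = map_poly complex_of_real (\<Prod>e\<leftarrow>es. [:- e, 1:])"
    unfolding P.hom_prod_list es_def map_map o_def using real
    by (intro arg_cong[of _ _ prod_list] map_cong) auto
  finally have "char_poly H = (\<Prod>e\<leftarrow>es. [:- e, 1:])" by simp
  moreover have "length es = n" using as(2) by (simp add: es_def)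
  ultimately show thesis using that by blast
qed

lemma scalar_prod_self_nonneg:
  fixes v :: "real vec"
  shows "0 \<le> v \<bullet> v"
  unfolding scalar_prod_def by (intro sum_nonneg) simp

lemma scalar_prod_self_pos:
  fixes v :: "real vec"
  assumes "v \<in> carrier_vec n" and "v \<noteq> 0\<^sub>v n"
  shows "0 < v \<bullet> v"
proof -
  have "v \<bullet> v \<noteq> 0" using conjugate_square_eq_0_vec[OF assms(1)] assms(2) by simp
  then show ?thesis using scalar_prod_self_nonneg[of v] by linarith
qed

text \<open>
  A unit vector \<open>v\<close> is the first column of a symmetric orthogonal matrix: the reflection
  \<open>1 - 2 u u\<^sup>T / (u\<^sup>T u)\<close> with \<open>u = v - e\<^sub>0\<close>, which exchanges \<open>e\<^sub>0\<close> and \<open>v\<close>.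
\<close>

lemma householder_reflection:
  fixes v :: "real vec"
  assumes v: "v \<in> carrier_vec n" and unit: "v \<bullet> v = 1" and n: "0 < n"
  obtains W where "W \<in> carrier_mat n n" and "W\<^sup>T = W" and "W * W = 1\<^sub>m n" and "col W 0 = v"
proof -
  define u where "u = v - unit_vec n 0"
  have u: "u \<in> carrier_vec n" using v unfolding u_def by simp
  have uu: "u \<bullet> u = 2 - 2 * v $ 0"
  proof -
    have "u \<bullet> u = v \<bullet> v - v \<bullet> unit_vec n 0 - (unit_vec n 0 \<bullet> v - unit_vec n 0 \<bullet> unit_vec n 0)"
      unfolding u_def using v
      by (simp add: minus_scalar_prod_distrib[of _ n] scalar_prod_minus_distrib[of _ n])
    then show ?thesis using v unit n by simp
  qed
  \<comment> \<open>For \<open>u = 0\<close> the convention \<open>2 / 0 = 0\<close> makes \<open>W\<close> the identity.\<close>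
  define c where "c = 2 / (u \<bullet> u)"
  have cuu: "c * (c * (u \<bullet> u)) = 2 * c" unfolding c_def by simp
  define W where "W = mat n n (\<lambda>(i, j). (if i = j then 1 else 0) - c * (u $ i * u $ j))"
  have W: "W \<in> carrier_mat n n" unfolding W_def by simp
  have 1: "W\<^sup>T = W" unfolding W_def by (intro eq_matI) auto
  have 2: "W * W = 1\<^sub>m n"
  proof (rule eq_matI)
    fix i j assume "i < dim_row (1\<^sub>m n)" "j < dim_col (1\<^sub>m n)"
    then have ij: "i < n" "j < n" by auto
    have "(W * W) $$ (i, j) = (\<Sum>l = 0..<n. W $$ (i, l) * W $$ (l, j))"
      using W ij by (simp add: scalar_prod_def)
    also have "\<dots> = (\<Sum>l = 0..<n. (if i = l then if l = j then 1 else 0 else 0)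
        - (if i = l then c * (u $ l * u $ j) else 0) - (if l = j then c * (u $ i * u $ l) else 0)
        + c * (c * (u $ l * u $ l)) * (u $ i * u $ j))"
      using ij by (intro sum.cong refl) (auto simp: W_def algebra_simps)
    also have "\<dots> = (if i = j then 1 else 0) - 2 * (c * (u $ i * u $ j))
        + c * (c * (u \<bullet> u)) * (u $ i * u $ j)"
      using ij u by (simp add: sum.distrib sum_subtractf scalar_prod_def sum_distrib_left sum_distrib_right)
    also have "\<dots> = 1\<^sub>m n $$ (i, j)" unfolding cuu using ij by simp
    finally show "(W * W) $$ (i, j) = 1\<^sub>m n $$ (i, j)" .
  qed (use W in auto)
  have 3: "col W 0 = v"
  proof (rule eq_vecI)
    fix i assume "i < dim_vec v"
    then have i: "i < n" using v by simp
    have u0: "u $ 0 = v $ 0 - 1" using n v by (simp add: u_def)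
    have "c * (u $ i * u $ 0) = - (u $ i)"
    proof (cases "u \<bullet> u = 0")
      case True
      then have "u = 0\<^sub>v n" using scalar_prod_self_pos[OF u] by linarith
      then show ?thesis using i by simp
    next
      case False
      have "u $ 0 = - (u \<bullet> u) / 2" using uu u0 by simp
      then show ?thesis using False unfolding c_def by simp
    qed
    then show "col W 0 $ i = v $ i" using i n v by (auto simp: W_def u_def)
  qed (use W v in simp)
  show thesis using that W 1 2 3 by blast
qed

text \<open>
  Deflation: conjugating with a reflection that takes \<open>e\<^sub>0\<close> to a unit eigenvector splits off a
  \<open>1 \<times> 1\<close> block, since a symmetric matrix whose first column is a multiple of \<open>e\<^sub>0\<close> also has its
  first row of that form. The eigenvalues appear on the diagonal in the order of the given
  factorization, which may therefore be chosen freely.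
\<close>

lemma real_spectral_theorem:
  fixes H :: "real mat"
  assumes "H \<in> carrier_mat n n" and "H\<^sup>T = H" and "char_poly H = (\<Prod>e\<leftarrow>es. [:- e, 1:])"
    and "length es = n"
  shows "\<exists>P \<in> carrier_mat n n. P\<^sup>T * P = 1\<^sub>m n \<and> P\<^sup>T * H * P = mat_diag n (\<lambda>i. es ! i)"
  using assms
proof (induction es arbitrary: H n)
  case Nil
  then show ?case by (intro bexI[of _ "1\<^sub>m 0"]) (auto simp: mat_diag_def)
next
  case (Cons e es)
  define m where "m = length es"
  have n: "n = Suc m" using Cons.prems by (simp add: m_def)
  have H: "H \<in> carrier_mat n n" and sym: "H\<^sup>T = H" using Cons.prems by auto
  have "eigenvalue H e" unfolding eigenvalue_root_char_poly[OF H] Cons.prems(3) by simp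
  then obtain x where x: "x \<in> carrier_vec n" "x \<noteq> 0\<^sub>v n" "H *\<^sub>v x = e \<cdot>\<^sub>v x"
    using H unfolding eigenvalue_def eigenvector_def by auto
  define v where "v = (1 / sqrt (x \<bullet> x)) \<cdot>\<^sub>v x"
  have v: "v \<in> carrier_vec n" using x by (simp add: v_def)
  have vv: "v \<bullet> v = 1" using scalar_prod_self_pos[OF x(1,2)] x(1)
    by (simp add: v_def)
  have Hv: "H *\<^sub>v v = e \<cdot>\<^sub>v v" using H x unfolding v_def
    by (simp add: mult_mat_vec[OF H x(1)] smult_smult_assoc mult.commute)
  obtain W where W: "W \<in> carrier_mat n n" "W\<^sup>T = W" "W * W = 1\<^sub>m n" "col W 0 = v"
    using householder_reflection[OF v vv] n by auto
  define B where "B = W * H * W"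
  have B: "B \<in> carrier_mat n n" using W H by (simp add: B_def)
  have Bsym: "B\<^sup>T = B" unfolding B_def using W H sym
    by (simp add: transpose_mult[of _ n n _ n])
  have colB: "col B 0 = e \<cdot>\<^sub>v unit_vec n 0"
  proof -
    have "B = W * (H * W)" using W(1) H by (simp add: B_def)
    then have "col B 0 = W *\<^sub>v col (H * W) 0"
      using col_mult2[OF W(1) mult_carrier_mat[OF H W(1)], of 0] n by (simp only: zero_less_Suc)
    also have "col (H * W) 0 = H *\<^sub>v v"
      using col_mult2[OF H W(1), of 0] n by (simp only: W(4) zero_less_Suc)
    also have "W *\<^sub>v (H *\<^sub>v v) = e \<cdot>\<^sub>v (W *\<^sub>v col W 0)" unfolding Hv using W v
      by (simp add: mult_mat_vec[OF W(1) v])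
    also have "W *\<^sub>v col W 0 = col (W * W) 0"
      using col_mult2[OF W(1,1), of 0] n by (simp only: zero_less_Suc)
    also have "\<dots> = unit_vec n 0" using W(3) n by simp
    finally show ?thesis .
  qed
  define H' where "H' = mat m m (\<lambda>(i, j). B $$ (Suc i, Suc j))"
  have H': "H' \<in> carrier_mat m m" by (simp add: H'_def)
  have Bsym': "B $$ (i, j) = B $$ (j, i)" if "i < n" "j < n" for i j
    using Bsym B that by (metis carrier_matD index_transpose_mat(1))
  have B0: "B $$ (i, 0) = (if i = 0 then e else 0)" if "i < n" for i
    using arg_cong[OF colB, of "\<lambda>v. v $ i"] B n that by auto
  let ?E = "mat 1 1 (\<lambda>_. e)"
  have blk: "B = four_block_mat ?E (0\<^sub>m 1 m) (0\<^sub>m m 1) H'"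
    using B n Bsym' B0 by (intro eq_matI) (auto simp: H'_def)
  have H'sym: "H'\<^sup>T = H'" using Bsym' n by (intro eq_matI) (auto simp: H'_def)
  have "W * B * W = (W * W) * H * (W * W)"
    unfolding B_def using W(1) H by (simp add: assoc_mult_mat[of _ n n _ n _ n])
  then have "H = W * B * W" using W(3) H by simp
  then have "similar_mat H B"
    using W H B by (intro similar_matI[of _ _ W W n]) auto
  then have "char_poly H = char_poly B" by (rule char_poly_similar)
  also have "\<dots> = char_poly ?E * char_poly H'"
    unfolding blk by (rule char_poly_four_block_zeros_col) (use H' in auto)
  also have "char_poly ?E = [:- e, 1:]" by (simp add: char_poly_defs det_single)
  finally have "[:- e, 1:] * char_poly H' = [:- e, 1:] * (\<Prod>e\<leftarrow>es. [:- e, 1:])"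
    using Cons.prems(3) by simp
  then have "char_poly H' = (\<Prod>e\<leftarrow>es. [:- e, 1:])"
    by (simp only: mult_cancel_left pCons_eq_0_iff one_neq_zero simp_thms)
  from Cons.IH[OF H' H'sym this] obtain P where P: "P \<in> carrier_mat m m" "P\<^sup>T * P = 1\<^sub>m m"
    "P\<^sup>T * H' * P = mat_diag m (\<lambda>i. es ! i)" by (auto simp: m_def)
  define Q where "Q = four_block_mat (1\<^sub>m 1) (0\<^sub>m 1 m) (0\<^sub>m m 1) P"
  have Q: "Q \<in> carrier_mat n n"
    unfolding Q_def n using four_block_carrier_mat[OF one_carrier_mat P(1), of 1] by simp
  have QT: "Q\<^sup>T = four_block_mat (1\<^sub>m 1) (0\<^sub>m 1 m) (0\<^sub>m m 1) P\<^sup>T"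
    unfolding Q_def using P by (subst transpose_four_block_mat) auto
  have PT: "P\<^sup>T \<in> carrier_mat m m" using P(1) by simp
  have E: "?E \<in> carrier_mat 1 1" by simp
  note mult = mult_four_block_mat[where ?nr1.0 = 1 and ?n1.0 = 1 and ?nc1.0 = 1 and ?B1.0 = "0\<^sub>m 1 m"
      and ?B2.0 = "0\<^sub>m 1 m" and ?C1.0 = "0\<^sub>m m 1" and ?C2.0 = "0\<^sub>m m 1",
      OF _ zero_carrier_mat zero_carrier_mat _ _ zero_carrier_mat zero_carrier_mat]
  have QQ: "Q\<^sup>T * Q = 1\<^sub>m n"
    unfolding QT unfolding Q_def n mult[OF one_carrier_mat PT one_carrier_mat P(1)]
    using P PT by simp
  have "Q\<^sup>T * B = four_block_mat ?E (0\<^sub>m 1 m) (0\<^sub>m m 1) (P\<^sup>T * H')"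
    unfolding QT blk mult[OF one_carrier_mat PT E H'] using PT H'
    by (simp add: left_mult_one_mat[OF E])
  moreover have "four_block_mat ?E (0\<^sub>m 1 m) (0\<^sub>m m 1) (P\<^sup>T * H') * Q
      = four_block_mat ?E (0\<^sub>m 1 m) (0\<^sub>m m 1) (P\<^sup>T * H' * P)"
    unfolding Q_def mult[OF E mult_carrier_mat[OF PT H'] one_carrier_mat P(1)] using P PT H'
    by (simp add: right_mult_one_mat[OF E])
  ultimately have QB: "Q\<^sup>T * B * Q = four_block_mat ?E (0\<^sub>m 1 m) (0\<^sub>m m 1) (mat_diag m (\<lambda>i. es ! i))"
    using P(3) by simp
  have QD: "Q\<^sup>T * B * Q = mat_diag n (\<lambda>i. (e # es) ! i)"
    unfolding QB n by (intro eq_matI) (auto simp: mat_diag_def)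
  define R where "R = W * Q"
  have R: "R \<in> carrier_mat n n" using W Q by (simp add: R_def)
  have RT: "R\<^sup>T = Q\<^sup>T * W" using W Q by (simp add: R_def transpose_mult[of _ n n _ n])
  have WWQ: "W * (W * Q) = Q" using assoc_mult_mat[OF W(1,1) Q] W(3) Q by simp
  have RR: "R\<^sup>T * R = 1\<^sub>m n"
    unfolding RT unfolding R_def using W(1) Q by (simp add: assoc_mult_mat[of _ n n _ n _ n] WWQ QQ)
  have "R\<^sup>T * H * R = Q\<^sup>T * B * Q"
    unfolding RT B_def unfolding R_def using W(1) Q H by (simp add: assoc_mult_mat[of _ n n _ n _ n])
  then show ?case using R RR QD by auto
qed

text \<open>
  The form in which the spectral theorem is applied: eigenvalues in decreasing order, the
  quadratic form \<open>x\<^sup>T H x\<close> in the coordinates \<open>P\<^sup>T x\<close> of an orthonormal eigenbasis, and each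
  eigenvalue as the value of the form at some unit vector.
\<close>

lemma symmetric_quadratic_form:
  fixes H :: "real mat"
  assumes H: "H \<in> carrier_mat n n" and sym: "H\<^sup>T = H"
  obtains es P where "length es = n" and "sorted_wrt (\<ge>) es"
    and "char_poly H = (\<Prod>e\<leftarrow>es. [:- e, 1:])"
    and "P \<in> carrier_mat n n" and "P\<^sup>T * P = 1\<^sub>m n"
    and "P\<^sup>T * H * P = mat_diag n (\<lambda>i. es ! i)"
    and "\<And>x. x \<in> carrier_vec n \<Longrightarrow> x \<bullet> x = (\<Sum>i<n. ((P\<^sup>T *\<^sub>v x) $ i)\<^sup>2)"
    and "\<And>x. x \<in> carrier_vec n \<Longrightarrow> x \<bullet> (H *\<^sub>v x) = (\<Sum>i<n. es ! i * ((P\<^sup>T *\<^sub>v x) $ i)\<^sup>2)"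
    and "\<And>i. i < n \<Longrightarrow> \<exists>x \<in> carrier_vec n. x \<bullet> x = 1 \<and> x \<bullet> (H *\<^sub>v x) = es ! i"
proof -
  obtain fs where fs: "char_poly H = (\<Prod>e\<leftarrow>fs. [:- e, 1:])" "length fs = n"
    using symmetric_char_poly_splits[OF H sym] by blast
  define es where "es = rev (sort fs)"
  have len: "length es = n" using fs by (simp add: es_def)
  have sorted: "sorted_wrt (\<ge>) es" unfolding es_def by (simp add: sorted_wrt_rev)
  have "mset (map (\<lambda>e. [:- e, 1:]) es) = mset (map (\<lambda>e. [:- e, 1:]) fs)"
    by (simp add: es_def)
  then have cp: "char_poly H = (\<Prod>e\<leftarrow>es. [:- e, 1:])"
    unfolding fs(1) by (metis prod_mset_prod_list)
  obtain P where P: "P \<in> carrier_mat n n" "P\<^sup>T * P = 1\<^sub>m n" "P\<^sup>T * H * P = mat_diag n (\<lambda>i. es ! i)"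
    using real_spectral_theorem[OF H sym cp len] by blast
  have PT: "P\<^sup>T \<in> carrier_mat n n" using P by simp
  have PPT: "P * P\<^sup>T = 1\<^sub>m n" using mat_mult_left_right_inverse[OF PT P(1,2)] .
  have "P * (P\<^sup>T * H * P) * P\<^sup>T = (P * P\<^sup>T) * H * (P * P\<^sup>T)"
    using P(1) PT H by (simp add: assoc_mult_mat[of _ n n _ n _ n])
  then have HD: "H = P * mat_diag n (\<lambda>i. es ! i) * P\<^sup>T" using P(3) PPT H by simp
  have 1: "x \<bullet> x = (\<Sum>i<n. ((P\<^sup>T *\<^sub>v x) $ i)\<^sup>2)" if x: "x \<in> carrier_vec n" for x
  proof -
    have "x \<bullet> x = ((P * P\<^sup>T) *\<^sub>v x) \<bullet> x" using PPT x by simp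
    also have "\<dots> = (P *\<^sub>v (P\<^sup>T *\<^sub>v x)) \<bullet> x"
      using P(1) PT x by (simp add: assoc_mult_mat_vec[of _ n n _ n])
    also have "\<dots> = (P\<^sup>T *\<^sub>v x) \<bullet> (P\<^sup>T *\<^sub>v x)"
      using transpose_vec_mult_scalar[OF PT, of x "P\<^sup>T *\<^sub>v x"] P(1) PT x
        comm_scalar_prod[of "P *\<^sub>v (P\<^sup>T *\<^sub>v x)" n x] by simp
    finally show ?thesis
      using P by (simp add: scalar_prod_def power2_eq_square lessThan_atLeast0)
  qed
  have 2: "x \<bullet> (H *\<^sub>v x) = (\<Sum>i<n. es ! i * ((P\<^sup>T *\<^sub>v x) $ i)\<^sup>2)" if x: "x \<in> carrier_vec n" for x
  proof -
    let ?D = "mat_diag n (\<lambda>i. es ! i)" and ?y = "P\<^sup>T *\<^sub>v x"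
    have D: "?D \<in> carrier_mat n n" by simp
    have y: "?y \<in> carrier_vec n" using PT x by simp
    have "H *\<^sub>v x = P *\<^sub>v (?D *\<^sub>v ?y)" unfolding HD
      using P(1) PT x D by (simp add: assoc_mult_mat_vec[of _ n n _ n])
    then have qf: "x \<bullet> (H *\<^sub>v x) = ?y \<bullet> (?D *\<^sub>v ?y)"
      using transpose_vec_mult_scalar[OF PT x mult_mat_vec_carrier[OF D y]] P(1) x
        comm_scalar_prod[OF x mult_mat_vec_carrier[OF P(1) mult_mat_vec_carrier[OF D y]]]
        comm_scalar_prod[OF y mult_mat_vec_carrier[OF D y]] by simp
    have diag: "z \<bullet> (?D *\<^sub>v z) = (\<Sum>i<n. z $ i * (es ! i * z $ i))" if z: "z \<in> carrier_vec n" for z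
    proof -
      have "(?D *\<^sub>v z) $ i = es ! i * z $ i" if i: "i < n" for i
      proof -
        have "(?D *\<^sub>v z) $ i = (\<Sum>j = 0..<n. (if i = j then es ! j * z $ j else 0))"
          using z i by (simp add: scalar_prod_def mat_diag_def if_distrib[of "\<lambda>e. e * _"] cong: if_cong)
        then show ?thesis using i by simp
      qed
      moreover have "dim_vec (?D *\<^sub>v z) = n" by (simp add: mat_diag_def)
      ultimately show ?thesis unfolding scalar_prod_def by (simp add: lessThan_atLeast0)
    qed
    show ?thesis unfolding qf diag[OF y] by (simp add: power2_eq_square algebra_simps)
  qed
  have 3: "\<exists>x \<in> carrier_vec n. x \<bullet> x = 1 \<and> x \<bullet> (H *\<^sub>v x) = es ! i" if i: "i < n" for i
  proof (intro bexI conjI)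
    show x: "col P i \<in> carrier_vec n" using P i by simp
    have "P\<^sup>T *\<^sub>v col P i = col (P\<^sup>T * P) i" by (rule col_mult2[OF PT P(1) i, symmetric])
    then have y: "P\<^sup>T *\<^sub>v col P i = unit_vec n i" using P i by simp
    have "col P i \<bullet> (H *\<^sub>v col P i) = (\<Sum>j<n. if j = i then es ! j else 0)"
      unfolding 2[OF x] y by (intro sum.cong) (use i in auto)
    then show "col P i \<bullet> (H *\<^sub>v col P i) = es ! i" using i by simp
    have "col P i \<bullet> col P i = (\<Sum>j<n. if j = i then 1 else 0)"
      unfolding 1[OF x] y by (intro sum.cong) (use i in auto)
    then show "col P i \<bullet> col P i = 1" using i by simp
  qed
  show thesis using that[OF len sorted cp P 1 2 3] .
qed

section \<open>Gram matrices and singular values\<close>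

lemma gram_quadratic_form:
  fixes A :: "'a :: comm_semiring_0 mat"
  assumes A: "A \<in> carrier_mat n m" and x: "x \<in> carrier_vec m"
  shows "x \<bullet> ((A\<^sup>T * A) *\<^sub>v x) = (A *\<^sub>v x) \<bullet> (A *\<^sub>v x)"
proof -
  have "(A\<^sup>T * A) *\<^sub>v x = A\<^sup>T *\<^sub>v (A *\<^sub>v x)"
    using A x by (simp add: assoc_mult_mat_vec[of _ m n _ m])
  then show ?thesis
    using transpose_vec_mult_scalar[OF A x, of "A *\<^sub>v x"] A x
      comm_scalar_prod[of "A\<^sup>T *\<^sub>v (A *\<^sub>v x)" m x] by simp
qed

lemma gram_symmetric:
  fixes A :: "'a :: comm_semiring_0 mat"
  assumes A: "A \<in> carrier_mat n m"
  shows "(A\<^sup>T * A)\<^sup>T = A\<^sup>T * A" "A\<^sup>T * A \<in> carrier_mat m m"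
  using A by (auto simp: transpose_mult[of _ m n _ m])

lemma singular_values_char_poly:
  assumes cp: "char_poly (A\<^sup>T * A) = (\<Prod>e\<leftarrow>es. [:- e, 1:])" and sorted: "sorted_wrt (\<ge>) es"
  shows "singular_values A = map sqrt es"
proof -
  have "proots (\<Prod>e\<leftarrow>es. [:- e, 1:]) = mset es" for es :: "real list"
  proof (induction es)
    case (Cons e es)
    have "(\<Prod>e\<leftarrow>es. [:- e, 1:]) \<noteq> 0" by (auto simp: prod_list_zero_iff)
    then show ?case using Cons
      by (simp add: proots_mult del: mult_pCons_left)
  qed simp
  moreover have "sorted (rev (map sqrt es))"
    using sorted by (simp add: sorted_wrt_rev sorted_wrt_map)
  ultimately show ?thesis unfolding singular_values_def cp
    by (metis mset_map mset_rev rev_rev_ident sorted_list_of_multiset_mset sorted_sort_id)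
qed

text \<open>
  The spectral theorem for \<open>A\<^sup>T A\<close>, stated for the squared length of \<open>A x\<close>. The squared
  singular values are the entries of \<open>es\<close>.
\<close>

lemma singular_values_quadratic_form:
  assumes A: "A \<in> carrier_mat n m"
  obtains es P where "length es = m" and "sorted_wrt (\<ge>) es"
    and "singular_values A = map sqrt es" and "P \<in> carrier_mat m m"
    and "\<And>x. x \<in> carrier_vec m \<Longrightarrow> x \<bullet> x = (\<Sum>i<m. ((P\<^sup>T *\<^sub>v x) $ i)\<^sup>2)"
    and "\<And>x. x \<in> carrier_vec m \<Longrightarrow>
      (A *\<^sub>v x) \<bullet> (A *\<^sub>v x) = (\<Sum>i<m. es ! i * ((P\<^sup>T *\<^sub>v x) $ i)\<^sup>2)"
    and "\<And>i. i < m \<Longrightarrow> \<exists>x \<in> carrier_vec m. (A *\<^sub>v x) \<bullet> (A *\<^sub>v x) = es ! i"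
proof -
  obtain es P where 1: "length es = m" "sorted_wrt (\<ge>) es"
    and cp: "char_poly (A\<^sup>T * A) = (\<Prod>e\<leftarrow>es. [:- e, 1:])"
    and P: "P \<in> carrier_mat m m" "P\<^sup>T * P = 1\<^sub>m m" "P\<^sup>T * (A\<^sup>T * A) * P = mat_diag m (\<lambda>i. es ! i)"
    and 2: "\<And>x. x \<in> carrier_vec m \<Longrightarrow> x \<bullet> x = (\<Sum>i<m. ((P\<^sup>T *\<^sub>v x) $ i)\<^sup>2)"
      "\<And>x. x \<in> carrier_vec m \<Longrightarrow> x \<bullet> ((A\<^sup>T * A) *\<^sub>v x) = (\<Sum>i<m. es ! i * ((P\<^sup>T *\<^sub>v x) $ i)\<^sup>2)"
    and 3: "\<And>i. i < m \<Longrightarrow> \<exists>x \<in> carrier_vec m. x \<bullet> x = 1 \<and> x \<bullet> ((A\<^sup>T * A) *\<^sub>v x) = es ! i"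
    by (rule symmetric_quadratic_form[OF gram_symmetric(2,1)[OF A]]) (rule that)
  note gram = gram_quadratic_form[OF A]
  show thesis
  proof (rule that[OF 1 singular_values_char_poly[OF cp 1(2)] P(1) 2(1)])
    show "(A *\<^sub>v x) \<bullet> (A *\<^sub>v x) = (\<Sum>i<m. es ! i * ((P\<^sup>T *\<^sub>v x) $ i)\<^sup>2)"
      if "x \<in> carrier_vec m" for x
      using 2(2)[OF that] gram[OF that] by simp
    show "\<exists>x \<in> carrier_vec m. (A *\<^sub>v x) \<bullet> (A *\<^sub>v x) = es ! i" if "i < m" for i
    proof -
      obtain x where "x \<in> carrier_vec m" "x \<bullet> ((A\<^sup>T * A) *\<^sub>v x) = es ! i" using 3[OF \<open>i < m\<close>] by blast
      then show ?thesis using gram by (intro bexI[of _ x]) auto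
    qed
  qed
qed

lemma singular_value_nonneg:
  assumes A: "A \<in> carrier_mat n m"
  shows "0 \<le> singular_value A q"
proof -
  obtain es P where es: "length es = m" "sorted_wrt (\<ge>) es" "singular_values A = map sqrt es"
    and P: "P \<in> carrier_mat m m"
    and sq: "\<And>x. x \<in> carrier_vec m \<Longrightarrow> x \<bullet> x = (\<Sum>i<m. ((P\<^sup>T *\<^sub>v x) $ i)\<^sup>2)"
    and qf: "\<And>x. x \<in> carrier_vec m \<Longrightarrow>
      (A *\<^sub>v x) \<bullet> (A *\<^sub>v x) = (\<Sum>i<m. es ! i * ((P\<^sup>T *\<^sub>v x) $ i)\<^sup>2)"
    and attained: "\<And>i. i < m \<Longrightarrow> \<exists>x \<in> carrier_vec m. (A *\<^sub>v x) \<bullet> (A *\<^sub>v x) = es ! i"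
    by (rule singular_values_quadratic_form[OF A]) (rule that)
  have "0 \<le> es ! i" if "i < m" for i
  proof -
    obtain x where "(A *\<^sub>v x) \<bullet> (A *\<^sub>v x) = es ! i" using attained[OF \<open>i < m\<close>] by blast
    then show ?thesis using scalar_prod_self_nonneg[of "A *\<^sub>v x"] by simp
  qed
  then show ?thesis unfolding singular_value_def es(3) using es(1) by auto
qed

lemma singular_value_pos_imp_dims:
  assumes A: "A \<in> carrier_mat n m" and pos: "0 < singular_value A q"
  shows "0 < n" and "0 < m"
proof -
  obtain es P where es: "length es = m" "sorted_wrt (\<ge>) es" "singular_values A = map sqrt es"
    and P: "P \<in> carrier_mat m m"
    and sq: "\<And>x. x \<in> carrier_vec m \<Longrightarrow> x \<bullet> x = (\<Sum>i<m. ((P\<^sup>T *\<^sub>v x) $ i)\<^sup>2)"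
    and qf: "\<And>x. x \<in> carrier_vec m \<Longrightarrow>
      (A *\<^sub>v x) \<bullet> (A *\<^sub>v x) = (\<Sum>i<m. es ! i * ((P\<^sup>T *\<^sub>v x) $ i)\<^sup>2)"
    and attained: "\<And>i. i < m \<Longrightarrow> \<exists>x \<in> carrier_vec m. (A *\<^sub>v x) \<bullet> (A *\<^sub>v x) = es ! i"
    by (rule singular_values_quadratic_form[OF A]) (rule that)
  from pos have q: "q - 1 < m" and *: "0 < es ! (q - 1)"
    unfolding singular_value_def es(3) using es(1) by (auto split: if_splits)
  show "0 < m" using q by simp
  show "0 < n"
  proof (rule ccontr)
    assume "\<not> 0 < n"
    then have "(A *\<^sub>v x) \<bullet> (A *\<^sub>v x) = 0" for x using A by (simp add: scalar_prod_def)
    then show False using attained[OF q] * by simp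
  qed
qed

section \<open>Minors and singular values\<close>

text \<open>
  If \<open>M\<close> does not increase lengths, the eigenvalues of \<open>M\<^sup>T M\<close> lie in \<open>[0, 1]\<close>, so their
  product \<open>(det M)\<^sup>2\<close> is at most each of them, hence at most every Rayleigh quotient.
\<close>

lemma det_square_le_contraction:
  fixes M :: "real mat"
  assumes M: "M \<in> carrier_mat N N" and v: "v \<in> carrier_vec N"
    and contr: "\<And>x. x \<in> carrier_vec N \<Longrightarrow> (M *\<^sub>v x) \<bullet> (M *\<^sub>v x) \<le> x \<bullet> x"
  shows "(det M)\<^sup>2 * (v \<bullet> v) \<le> (M *\<^sub>v v) \<bullet> (M *\<^sub>v v)"
proof -
  let ?H = "M\<^sup>T * M"
  obtain es P where "length es = N" "sorted_wrt (\<ge>) es" "char_poly ?H = (\<Prod>e\<leftarrow>es. [:- e, 1:])"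
    and P: "P \<in> carrier_mat N N" "P\<^sup>T * P = 1\<^sub>m N"
      "P\<^sup>T * ?H * P = mat_diag N (\<lambda>i. es ! i)"
    and sq: "\<And>x. x \<in> carrier_vec N \<Longrightarrow> x \<bullet> x = (\<Sum>i<N. ((P\<^sup>T *\<^sub>v x) $ i)\<^sup>2)"
    and qf: "\<And>x. x \<in> carrier_vec N \<Longrightarrow> x \<bullet> (?H *\<^sub>v x) = (\<Sum>i<N. es ! i * ((P\<^sup>T *\<^sub>v x) $ i)\<^sup>2)"
    and attained: "\<And>i. i < N \<Longrightarrow> \<exists>x \<in> carrier_vec N. x \<bullet> x = 1 \<and> x \<bullet> (?H *\<^sub>v x) = es ! i"
    by (rule symmetric_quadratic_form[OF gram_symmetric(2,1)[OF M]]) (rule that)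
  have bounds: "0 \<le> es ! i \<and> es ! i \<le> 1" if i: "i < N" for i
  proof -
    obtain x where x: "x \<in> carrier_vec N" "x \<bullet> x = 1" "x \<bullet> (?H *\<^sub>v x) = es ! i"
      using attained[OF i] by blast
    then show ?thesis
      using gram_quadratic_form[OF M x(1)] contr[OF x(1)] scalar_prod_self_nonneg[of "M *\<^sub>v x"] by simp
  qed
  have "(det M)\<^sup>2 = det ?H" using M by (simp add: det_mult[of _ N] det_transpose power2_eq_square)
  also have "\<dots> = (det P\<^sup>T * det P) * det ?H"
    using det_mult[of "P\<^sup>T" N P] P by simp
  also have "\<dots> = det (P\<^sup>T * ?H * P)"
    using P(1) gram_symmetric(2)[OF M] by (simp add: det_mult[of _ N])
  also have "\<dots> = (\<Prod>i<N. es ! i)"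
    unfolding P(3) by (subst det_upper_triangular[of _ N])
      (auto simp: mat_diag_def prod_list_diag_prod lessThan_atLeast0)
  finally have det: "(det M)\<^sup>2 = (\<Prod>i<N. es ! i)" .
  have le: "(det M)\<^sup>2 \<le> es ! i" if i: "i < N" for i
  proof -
    have "(\<Prod>i<N. es ! i) = es ! i * (\<Prod>j\<in>{..<N} - {i}. es ! j)"
      using i by (intro prod.remove) auto
    also have "\<dots> \<le> es ! i * 1"
      using bounds i by (intro mult_left_mono prod_le_1) auto
    finally show ?thesis using det by simp
  qed
  have "(det M)\<^sup>2 * (v \<bullet> v) = (\<Sum>i<N. (det M)\<^sup>2 * ((P\<^sup>T *\<^sub>v v) $ i)\<^sup>2)"
    unfolding sq[OF v] by (simp add: sum_distrib_left)
  also have "\<dots> \<le> (\<Sum>i<N. es ! i * ((P\<^sup>T *\<^sub>v v) $ i)\<^sup>2)"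
    using le by (intro sum_mono mult_right_mono) auto
  also have "\<dots> = (M *\<^sub>v v) \<bullet> (M *\<^sub>v v)" using qf[OF v] gram_quadratic_form[OF M v] by simp
  finally show ?thesis .
qed

lemma sum_nth_distinct:
  fixes g :: "nat \<Rightarrow> 'a :: comm_monoid_add"
  assumes "distinct J" and "set J \<subseteq> {..<m}" and "\<And>l. l < m \<Longrightarrow> l \<notin> set J \<Longrightarrow> g l = 0"
  shows "(\<Sum>l<m. g l) = (\<Sum>b<length J. g (J ! b))"
proof -
  have "(\<Sum>b<length J. g (J ! b)) = (\<Sum>l\<in>set J. g l)"
    using bij_betw_nth[OF assms(1) refl refl] by (rule sum.reindex_bij_betw)
  also have "\<dots> = (\<Sum>l<m. g l)" using assms(2,3) by (intro sum.mono_neutral_left) auto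
  finally show ?thesis by simp
qed

text \<open>
  For distinct indices, multiplying with a submatrix amounts to spreading \<open>v\<close> over the
  coordinates \<open>J\<close>, which preserves lengths, applying \<open>A\<close>, and keeping only the coordinates \<open>I\<close>,
  which does not increase lengths. The third part holds for every matrix \<open>B\<close> with \<open>m\<close>
  columns; below it is also applied to the transposed eigenbasis.
\<close>

lemma select_submat_as_compression:
  fixes A :: "real mat"
  assumes A: "A \<in> carrier_mat n m" and I: "set I \<subseteq> {..<n}" "distinct I"
    and J: "set J \<subseteq> {..<m}" "distinct J" and v: "v \<in> carrier_vec (length J)"
  defines "x \<equiv> vec m (\<lambda>l. \<Sum>b<length J. if J ! b = l then v $ b else 0)"
  defines "w \<equiv> select_submat A I J *\<^sub>v v"
  shows "x \<bullet> x = v \<bullet> v" and "w \<bullet> w \<le> (A *\<^sub>v x) \<bullet> (A *\<^sub>v x)"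
    and "B \<in> carrier_mat r m \<Longrightarrow> i < r \<Longrightarrow> (B *\<^sub>v x) $ i = (\<Sum>b<length J. B $$ (i, J ! b) * v $ b)"
proof -
  have x: "x \<in> carrier_vec m" by (simp add: x_def)
  have Jm: "J ! b < m" if "b < length J" for b using J(1) that nth_mem by fastforce
  have In: "I ! a < n" if "a < length I" for a using I(1) that nth_mem by fastforce
  have xJ: "x $ (J ! b) = v $ b" if b: "b < length J" for b
  proof -
    have "x $ (J ! b) = (\<Sum>c<length J. if c = b then v $ c else 0)"
      unfolding x_def using Jm[OF b] b J(2) by (simp add: nth_eq_iff_index_eq)
    then show ?thesis using b by simp
  qed
  have x0: "x $ l = 0" if "l < m" "l \<notin> set J" for l
    unfolding x_def using that by (auto intro!: sum.neutral)
  have "x \<bullet> x = (\<Sum>b<length J. x $ (J ! b) * x $ (J ! b))"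
    unfolding scalar_prod_def using x x0 sum_nth_distinct[OF J(2,1), of "\<lambda>l. x $ l * x $ l"]
    by (simp add: lessThan_atLeast0)
  then show "x \<bullet> x = v \<bullet> v" using v xJ by (simp add: scalar_prod_def lessThan_atLeast0)
  show mult: "(B *\<^sub>v x) $ i = (\<Sum>b<length J. B $$ (i, J ! b) * v $ b)"
    if B: "B \<in> carrier_mat r m" and i: "i < r" for B r i
  proof -
    have "(B *\<^sub>v x) $ i = (\<Sum>l<m. B $$ (i, l) * x $ l)"
      using B i x by (simp add: scalar_prod_def lessThan_atLeast0)
    also have "\<dots> = (\<Sum>b<length J. B $$ (i, J ! b) * x $ (J ! b))"
      using x0 by (intro sum_nth_distinct J) auto
    finally show ?thesis using xJ by simp
  qed
  have w: "w $ a = (A *\<^sub>v x) $ (I ! a)" if a: "a < length I" for a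
    unfolding mult[OF A In[OF a]] w_def select_submat_def using a v
    by (simp add: scalar_prod_def lessThan_atLeast0)
  have "w \<bullet> w = (\<Sum>a<length I. ((A *\<^sub>v x) $ (I ! a))\<^sup>2)"
    using w by (simp add: scalar_prod_def w_def select_submat_def lessThan_atLeast0 power2_eq_square)
  also have "\<dots> = (\<Sum>l\<in>set I. ((A *\<^sub>v x) $ l)\<^sup>2)"
    using bij_betw_nth[OF I(2) refl refl] by (rule sum.reindex_bij_betw)
  also have "\<dots> \<le> (\<Sum>l<n. ((A *\<^sub>v x) $ l)\<^sup>2)" using I(1) by (intro sum_mono2) auto
  also have "\<dots> = (A *\<^sub>v x) \<bullet> (A *\<^sub>v x)"
    using A by (simp add: scalar_prod_def lessThan_atLeast0 power2_eq_square)
  finally show "w \<bullet> w \<le> (A *\<^sub>v x) \<bullet> (A *\<^sub>v x)" .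
qed

lemma det_select_submat_not_distinct:
  fixes A :: "'a :: comm_ring_1 mat"
  assumes len: "length I = length J" and nd: "\<not> (distinct I \<and> distinct J)"
  shows "det (select_submat A I J) = 0"
proof -
  let ?M = "select_submat A I J"
  have M: "?M \<in> carrier_mat (length J) (length J)" using len by (simp add: select_submat_def)
  from nd consider (I) "\<not> distinct I" | (J) "\<not> distinct J" by blast
  then show ?thesis
  proof cases
    case I
    then obtain a b where ab: "a < length I" "b < length I" "a \<noteq> b" "I ! a = I ! b"
      by (auto simp: distinct_conv_nth)
    then have "row ?M a = row ?M b" by (intro eq_vecI) (auto simp: select_submat_def)
    then show ?thesis using det_identical_rows[OF M ab(3)] ab len by simp
  next
    case J
    then obtain a b where ab: "a < length J" "b < length J" "a \<noteq> b" "J ! a = J ! b"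
      by (auto simp: distinct_conv_nth)
    then have "col ?M a = col ?M b" by (intro eq_vecI) (auto simp: select_submat_def)
    then show ?thesis using det_identical_columns[OF M ab(3)] ab by simp
  qed
qed

text \<open>
  For distinct indices the submatrix \<open>M\<close> is a contraction, because \<open>A\<close> is one. The vectors
  supported on \<open>J\<close> form a space of dimension \<open>k + 1\<close>, so some nonzero one is orthogonal to
  the first \<open>k\<close> eigenvectors of \<open>A\<^sup>T A\<close>; \<open>A\<close>, and with it \<open>M\<close>, stretches it by at most the
  singular value with number \<open>k + 1\<close>. The bound for contractions, \<open>det_square_le_contraction\<close>, applies to
  this vector.
\<close>

lemma abs_minor_le_singular_value:
  fixes A :: "real mat"
  assumes A: "A \<in> carrier_mat n m" and I: "set I \<subseteq> {..<n}" "length I = Suc k"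
    and J: "set J \<subseteq> {..<m}" "length J = Suc k" and top: "singular_value A 1 \<le> 1"
  shows "\<bar>det (select_submat A I J)\<bar> \<le> singular_value A (Suc k)"
proof (cases "distinct I \<and> distinct J")
  case False
  then show ?thesis
    using det_select_submat_not_distinct[of I J A] I J singular_value_nonneg[OF A] by simp
next
  case True
  let ?M = "select_submat A I J"
  have M: "?M \<in> carrier_mat (Suc k) (Suc k)" using I J by (simp add: select_submat_def)
  have km: "k < m"
    using True J card_mono[of "{..<m}" "set J"] by (simp add: distinct_card)
  obtain es P where es: "length es = m" "sorted_wrt (\<ge>) es" "singular_values A = map sqrt es"
    and P: "P \<in> carrier_mat m m"
    and sq: "\<And>x. x \<in> carrier_vec m \<Longrightarrow> x \<bullet> x = (\<Sum>i<m. ((P\<^sup>T *\<^sub>v x) $ i)\<^sup>2)"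
    and qf: "\<And>x. x \<in> carrier_vec m \<Longrightarrow>
      (A *\<^sub>v x) \<bullet> (A *\<^sub>v x) = (\<Sum>i<m. es ! i * ((P\<^sup>T *\<^sub>v x) $ i)\<^sup>2)"
    and attained: "\<And>i. i < m \<Longrightarrow> \<exists>x \<in> carrier_vec m. (A *\<^sub>v x) \<bullet> (A *\<^sub>v x) = es ! i"
    by (rule singular_values_quadratic_form[OF A]) (rule that)
  have mono: "es ! j \<le> es ! i" if "i \<le> j" "j < m" for i j
    using es(1,2) that by (cases "i = j") (auto simp: sorted_wrt_iff_nth_less)
  have "es ! 0 \<le> 1" using top km unfolding singular_value_def es(3) by (simp add: es(1))
  then have le1: "es ! i \<le> 1" if "i < m" for i using mono[of 0 i] that by simp
  define X where "X v = vec m (\<lambda>l. \<Sum>b<length J. if J ! b = l then v $ b else 0)" for v :: "real vec"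
  have X: "X v \<in> carrier_vec m" for v by (simp add: X_def)
  note XX = select_submat_as_compression[OF A I(1) _ J(1), folded X_def, unfolded J(2)]
  have contr: "(?M *\<^sub>v v) \<bullet> (?M *\<^sub>v v) \<le> v \<bullet> v" if v: "v \<in> carrier_vec (Suc k)" for v
  proof -
    have "(?M *\<^sub>v v) \<bullet> (?M *\<^sub>v v) \<le> (A *\<^sub>v X v) \<bullet> (A *\<^sub>v X v)" using XX(2) True v by blast
    also have "\<dots> \<le> (\<Sum>i<m. 1 * ((P\<^sup>T *\<^sub>v X v) $ i)\<^sup>2)"
      unfolding qf[OF X] using le1 by (intro sum_mono mult_right_mono) auto
    also have "\<dots> = v \<bullet> v" using sq[OF X] XX(1) True v by simp
    finally show ?thesis .
  qed
  \<comment> \<open>The orthogonality conditions are \<open>k\<close> equations in \<open>k + 1\<close> unknowns; a zero row makes the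
    system square, so that a vanishing determinant yields a nonzero solution.\<close>
  define C where "C = mat (Suc k) (Suc k) (\<lambda>(a, b). if a < k then P $$ (J ! b, a) else 0)"
  have C: "C \<in> carrier_mat (Suc k) (Suc k)" by (simp add: C_def)
  have "det C = 0"
  proof -
    have "C\<^sup>T *\<^sub>v unit_vec (Suc k) k = 0\<^sub>v (Suc k)"
      by (intro eq_vecI) (auto simp: C_def)
    moreover have "unit_vec (Suc k) k \<noteq> (0\<^sub>v (Suc k) :: real vec)"
      by (metis index_unit_vec(2) index_zero_vec(1) lessI zero_neq_one)
    ultimately have "det C\<^sup>T = 0"
      using det_0_iff_vec_prod_zero[of "C\<^sup>T" "Suc k"] C
      by (metis transpose_carrier_mat unit_vec_carrier)
    then show ?thesis using det_transpose[OF C] by simp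
  qed
  then obtain v where v: "v \<in> carrier_vec (Suc k)" "v \<noteq> 0\<^sub>v (Suc k)" "C *\<^sub>v v = 0\<^sub>v (Suc k)"
    using det_0_iff_vec_prod_zero[OF C] by blast
  have Jm: "J ! b < m" if "b < Suc k" for b
    using subsetD[OF J(1) nth_mem, of b] J(2) that by simp
  have y0: "(P\<^sup>T *\<^sub>v X v) $ a = 0" if a: "a < k" for a
  proof -
    have "(P\<^sup>T *\<^sub>v X v) $ a = (\<Sum>b<Suc k. P\<^sup>T $$ (a, J ! b) * v $ b)"
      using XX(3)[of v "P\<^sup>T" m a] True v P a km by simp
    also have "\<dots> = (\<Sum>b<Suc k. P $$ (J ! b, a) * v $ b)"
      using P a km Jm by (intro sum.cong refl) simp
    also have "\<dots> = (C *\<^sub>v v) $ a"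
      using a v(1) by (simp add: C_def scalar_prod_def lessThan_atLeast0)
    finally show ?thesis using v a by simp
  qed
  have "(det ?M)\<^sup>2 * (v \<bullet> v) \<le> (?M *\<^sub>v v) \<bullet> (?M *\<^sub>v v)"
    by (rule det_square_le_contraction[OF M v(1) contr])
  also have "\<dots> \<le> (A *\<^sub>v X v) \<bullet> (A *\<^sub>v X v)" using XX(2) True v by blast
  also have "\<dots> \<le> (\<Sum>i<m. es ! k * ((P\<^sup>T *\<^sub>v X v) $ i)\<^sup>2)"
    unfolding qf[OF X]
  proof (intro sum_mono)
    fix i assume i: "i \<in> {..<m}"
    show "es ! i * ((P\<^sup>T *\<^sub>v X v) $ i)\<^sup>2 \<le> es ! k * ((P\<^sup>T *\<^sub>v X v) $ i)\<^sup>2"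
      using y0[of i] mono[of k i] i by (cases "i < k") (auto intro: mult_right_mono)
  qed
  also have "\<dots> = es ! k * (v \<bullet> v)"
    using sq[OF X] XX(1) True v(1) by (simp add: sum_distrib_left[symmetric])
  finally have "(det ?M)\<^sup>2 \<le> es ! k" using scalar_prod_self_pos[OF v(1,2)] by simp
  then have "\<bar>det ?M\<bar> \<le> sqrt (es ! k)" by (metis real_sqrt_abs real_sqrt_le_mono)
  then show ?thesis unfolding singular_value_def es(3) using km es(1) by simp
qed

section \<open>The Schur complement\<close>

text \<open>
  Appending row \<open>i\<close> and column \<open>j\<close> to \<open>S\<close> multiplies the determinant by the Schur complement
  of \<open>S\<close>, which is entry \<open>(i, j)\<close> of the residual. Nothing is assumed about \<open>i\<close> and \<open>j\<close>
  beyond their range: if \<open>i\<close> is in \<open>I\<close> or \<open>j\<close> is in \<open>J\<close>, both sides vanish.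
\<close>

lemma det_bordered_submat:
  fixes A :: "'a :: field mat"
  assumes A: "A \<in> carrier_mat n m"
    and I: "length I = k" "set I \<subseteq> {..<n}" and J: "length J = k" "set J \<subseteq> {..<m}"
    and S: "S = select_submat A I J" and inv: "invertible_mat S" and i: "i < n" and j: "j < m"
  shows "det (select_submat A (I @ [i]) (J @ [j]))
    = det S * (A - select_cols A J * inverse_mat S * select_rows A I) $$ (i, j)"
proof -
  have SC: "S \<in> carrier_mat k k" using S I J by (simp add: select_submat_def)
  define T where "T = inverse_mat S"
  have T: "T \<in> carrier_mat k k" "S * T = 1\<^sub>m k" using inverse_mat[OF SC inv] by (auto simp: T_def)
  define c where "c = mat 1 k (\<lambda>(_, b). A $$ (i, J ! b))"
  define b where "b = mat k 1 (\<lambda>(a, _). A $$ (I ! a, j))"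
  have c: "c \<in> carrier_mat 1 k" and b: "b \<in> carrier_mat k 1" by (auto simp: c_def b_def)
  let ?d = "mat 1 1 (\<lambda>_. A $$ (i, j))"
  let ?E = "?d - c * (T * b)"
  have E: "?E \<in> carrier_mat 1 1"
    by (intro minus_carrier_mat mult_carrier_mat[OF c] mult_carrier_mat[OF T(1) b])
  have blk: "select_submat A (I @ [i]) (J @ [j]) = four_block_mat S b c ?d"
    using I J unfolding S select_submat_def c_def b_def
    by (intro eq_matI) (auto simp: nth_append)
  have "four_block_mat S (0\<^sub>m k 1) c (1\<^sub>m 1) * four_block_mat (1\<^sub>m k) (T * b) (0\<^sub>m 1 k) ?E
      = four_block_mat (S * 1\<^sub>m k + 0\<^sub>m k 1 * 0\<^sub>m 1 k) (S * (T * b) + 0\<^sub>m k 1 * ?E)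
          (c * 1\<^sub>m k + 1\<^sub>m 1 * 0\<^sub>m 1 k) (c * (T * b) + 1\<^sub>m 1 * ?E)"
    using SC c b T E by (intro mult_four_block_mat) auto
  also have "S * (T * b) + 0\<^sub>m k 1 * ?E = b"
    using SC T b left_mult_zero_mat[OF E] by (simp add: assoc_mult_mat[of S k k T k b 1, symmetric])
  also have "c * (T * b) + 1\<^sub>m 1 * ?E = ?d"
    unfolding left_mult_one_mat[OF E] using c b by (intro eq_matI) auto
  also have "S * 1\<^sub>m k + 0\<^sub>m k 1 * 0\<^sub>m 1 k = S" using SC by simp
  also have "c * 1\<^sub>m k + 1\<^sub>m 1 * 0\<^sub>m 1 k = c" using c by simp
  finally have fac: "four_block_mat S b c ?d
      = four_block_mat S (0\<^sub>m k 1) c (1\<^sub>m 1) * four_block_mat (1\<^sub>m k) (T * b) (0\<^sub>m 1 k) ?E" ..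
  have "det (four_block_mat S b c ?d)
      = det (four_block_mat S (0\<^sub>m k 1) c (1\<^sub>m 1)) * det (four_block_mat (1\<^sub>m k) (T * b) (0\<^sub>m 1 k) ?E)"
    unfolding fac using SC c b T E by (intro det_mult[of _ "k + 1"]) auto
  also have "det (four_block_mat S (0\<^sub>m k 1) c (1\<^sub>m 1)) = det S"
    using SC c by (simp add: det_four_block_mat_upper_right_zero[of _ k _ 1])
  also have "det (four_block_mat (1\<^sub>m k) (T * b) (0\<^sub>m 1 k) ?E) = det ?E"
    using T b E by (simp add: det_four_block_mat_lower_left_zero[of _ k _ 1])
  also have "det ?E = ?E $$ (0, 0)" using E by (rule det_single)
  also have "?E $$ (0, 0) = (A - select_cols A J * T * select_rows A I) $$ (i, j)"
  proof -
    let ?C = "select_cols A J" and ?R = "select_rows A I"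
    have C: "?C \<in> carrier_mat n k" and R: "?R \<in> carrier_mat k m"
      using A I J by (auto simp: select_cols_def select_rows_def)
    have rowC: "row ?C i = row c 0"
    proof (rule eq_vecI)
      fix q assume "q < dim_vec (row c 0)"
      then have q: "q < k" using c by simp
      then have "J ! q < m" using J nth_mem by fastforce
      then show "row ?C i $ q = row c 0 $ q"
        using A J i q by (simp add: select_cols_def c_def mat_of_cols_index)
    qed (use C c in simp)
    have colR: "col ?R j = col b 0"
    proof (rule eq_vecI)
      fix q assume "q < dim_vec (col b 0)"
      then have q: "q < k" using b by simp
      then have "I ! q < n" using I nth_mem by fastforce
      then show "col ?R j $ q = col b 0 $ q"
        using A I j q by (simp add: select_rows_def b_def mat_of_rows_index)
    qed (use R b in simp)
    have "(?C * T * ?R) $$ (i, j) = (?C * (T * ?R)) $$ (i, j)"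
      using C T R by (simp add: assoc_mult_mat[of _ n k _ k _ m])
    also have "\<dots> = row ?C i \<bullet> (T *\<^sub>v col ?R j)"
      using C T R i j col_mult2[OF T(1) R j] by (simp del: col_mult)
    also have "\<dots> = (c * (T * b)) $$ (0, 0)"
      unfolding rowC colR using c T b col_mult2[OF T(1) b, of 0] by (simp del: col_mult)
    finally show ?thesis using A C T R c b i j by simp
  qed
  finally show ?thesis unfolding blk T_def .
qed

section \<open>The bound on the residual\<close>

theorem corollary2p6:
  fixes A S :: "real mat" and n m k :: nat and I J :: "nat list"
  assumes "A \<in> carrier_mat n m"
    and "length I = k" and "set I \<subseteq> {..<n}"
    and "length J = k" and "set J \<subseteq> {..<m}"
    and "S = select_submat A I J"
    and "invertible_mat S"
    and "singular_value A 1 = 1"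
  shows "max_norm (A - select_cols A J * inverse_mat S * select_rows A I)
           \<le> singular_value A (k + 1) / \<bar>det S\<bar>"
proof -
  let ?E = "A - select_cols A J * inverse_mat S * select_rows A I"
  have S: "S \<in> carrier_mat k k" using assms by (simp add: select_submat_def)
  have "det S * det (inverse_mat S) = 1"
    using det_mult[OF S inverse_mat(1)[OF S assms(7)]] inverse_mat(2)[OF S assms(7)] by simp
  then have det: "0 < \<bar>det S\<bar>" by auto
  have E: "?E \<in> carrier_mat n m"
    using assms by (intro minus_carrier_mat) (auto simp: select_cols_def select_rows_def)
  have dims: "0 < n" "0 < m" using singular_value_pos_imp_dims[OF assms(1), of 1] assms(8) by auto
  have entry: "\<bar>?E $$ (i, j)\<bar> \<le> singular_value A (k + 1) / \<bar>det S\<bar>" if "i < n" "j < m" for i j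
  proof -
    have "\<bar>det S * ?E $$ (i, j)\<bar> \<le> singular_value A (k + 1)"
      using abs_minor_le_singular_value[OF assms(1), of "I @ [i]" k "J @ [j]"] assms that
        det_bordered_submat[OF assms(1-7) that] by simp
    then show ?thesis using det by (simp add: abs_mult pos_le_divide_eq mult.commute)
  qed
  have fin: "finite (abs ` elements_mat ?E)" by (simp add: elements_mat_def)
  \<comment> \<open>The nonzero singular value makes both dimensions positive, so \<open>Max\<close> ranges over a
    nonempty set.\<close>
  have "?E $$ (0, 0) \<in> elements_mat ?E" using E dims by (intro elements_matI[OF E]) auto
  then have "abs ` elements_mat ?E \<noteq> {}" by blast
  moreover have "\<forall>e \<in> abs ` elements_mat ?E. e \<le> singular_value A (k + 1) / \<bar>det S\<bar>"
    using entry E by (auto dest!: elements_matD)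
  ultimately show ?thesis unfolding max_norm_def using fin by (simp add: Max_le_iff)
qed

end
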